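(* Let $X$ be a polygonal $\mathbb{Z}^2$-subshift. Then any two minimal recoding polygons for $X$ which are homothetic differ by a translation. In particular, if $X$ is triangular, then any two minimal recoding polygons for $X$ differ by a translation.
   Context: Subshifts and coding. For a finite alphabet $\mathcal{A}$ (discrete topology), a $\mathbb{Z}^2$-subshift is a closed subset $X\subset\mathcal{A}^{\mathbb{Z}^2}$ (product topology) invariant under the shifts $(T^ux)(v)=x(u+v)$, $u\in\mathbb{Z}^2$. For $A,B\subset\mathbb{R}^2$, $A$ $X$-codes $B$ if whenever $x,x'\in X$ agree on $A\cap\mathbb{Z}^2$ they agree on $B\cap\mathbb{Z}^2$. Recoding. A $\mathbb{Z}^2$-subshift $Y$ (possibly over another finite alphabet) is a recoding of $X$ if there are a finite set $F\subset\mathbb{Z}^2$ and a homeomorphism $\Psi:X\to Y$ commuting with the shift actions such that for all $(i,j)\in\mathbb{Z}^2$ and $x,x'\in X$: $\Psi(x)(i,j)=\Psi(x')(i,j)$ if and only if $x$ and $x'$ agree on $F+(i,j)$. Polygons. An integer polygon is a polygon in $\mathbb{R}^2$ (including its interior) with all vertices in $\mathbb{Z}^2$. A convex integer polygon $\mathcal{P}$ is a coding polygon for an infinite $\mathbb{Z}^2$-subshift $X$ if for every vertex $v$ of $\mathcal{P}$, $\mathcal{P}\setminus\{v\}$ $X$-codes $\{v\}$. $X$ is polygonal if it is infinite and has a coding polygon; it is triangular if it has a coding polygon that is a (nondegenerate) triangle. Degenerate coding polygons are allowed: a line segment with distinct endpoints in $\mathbb{Z}^2$ is regarded as a polygon with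 two vertices (its endpoints) and two edges (the segment with each of its two orientations). Minimal recoding polygons. Let $\mathcal{P}(X)$ be the class of all coding polygons of all recodings of $X$. A polygon $\mathcal{P}_0\in\mathcal{P}(X)$ is a minimal recoding polygon for $X$ if it has the minimal number of edges among all elements of $\mathcal{P}(X)$ and is minimal under inclusion among the elements of $\mathcal{P}(X)$ with that number of edges. *)

theory Defs
  imports "HOL-Analysis.Analysis"
begin

section \<open>Subshifts and recodings\<close>

text \<open>Alphabets are finite sets \<open>A\<close> rather than types, so that one can quantify over them. A
  configuration is a function on \<open>int \<times> int\<close>, addition there being componentwise.\<close>

type_synonym 'a config = "int \<times> int \<Rightarrow> 'a"

definition shift :: "int \<times> int \<Rightarrow> 'a config \<Rightarrow> 'a config" where
  "shift u x = (\<lambda>v. x (u + v))"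

definition full_shift :: "'a set \<Rightarrow> 'a config topology" where
  "full_shift A = product_topology (\<lambda>_. discrete_topology A) UNIV"

definition subshift :: "'a set \<Rightarrow> 'a config set \<Rightarrow> bool" where
  "subshift A X \<longleftrightarrow>
     finite A \<and> closedin (full_shift A) X \<and> (\<forall>u. shift u ` X \<subseteq> X)"

definition recoding ::
    "'a set \<Rightarrow> 'a config set \<Rightarrow> 'b set \<Rightarrow> 'b config set \<Rightarrow> bool" where
  "recoding A X B Y \<longleftrightarrow> subshift B Y \<and>
     (\<exists>(F :: (int \<times> int) set) \<Psi>. finite F \<and>
        homeomorphic_map (subtopology (full_shift A) X) (subtopology (full_shift B) Y) \<Psi> \<and>
        (\<forall>u. \<forall>x\<in>X. \<Psi> (shift u x) = shift u (\<Psi> x)) \<and>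
        (\<forall>u. \<forall>x\<in>X. \<forall>x'\<in>X. \<Psi> x u = \<Psi> x' u \<longleftrightarrow> (\<forall>f\<in>F. x (f + u) = x' (f + u))))"

section \<open>Coding polygons\<close>

definition lattice_point :: "int \<times> int \<Rightarrow> real \<times> real" where
  "lattice_point u = (of_int (fst u), of_int (snd u))"

definition agree_on :: "(real \<times> real) set \<Rightarrow> 'a config \<Rightarrow> 'a config \<Rightarrow> bool" where
  "agree_on S x x' \<longleftrightarrow> (\<forall>u. lattice_point u \<in> S \<longrightarrow> x u = x' u)"

definition codes :: "'a config set \<Rightarrow> (real \<times> real) set \<Rightarrow> (real \<times> real) set \<Rightarrow> bool" where
  "codes X S T \<longleftrightarrow> (\<forall>x\<in>X. \<forall>x'\<in>X. agree_on S x x' \<longrightarrow> agree_on T x x')"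

text \<open>The condition \<open>1 \<le> aff_dim P\<close> admits nondegenerate polygons (dimension 2) and segments
  with distinct endpoints (dimension 1), but neither single points nor the empty set.\<close>

definition convex_integer_polygon :: "(real \<times> real) set \<Rightarrow> bool" where
  "convex_integer_polygon P \<longleftrightarrow>
     polytope P \<and> 1 \<le> aff_dim P \<and> (\<forall>v. v extreme_point_of P \<longrightarrow> v \<in> range lattice_point)"

definition coding_polygon :: "'a config set \<Rightarrow> (real \<times> real) set \<Rightarrow> bool" where
  "coding_polygon X P \<longleftrightarrow> infinite X \<and> convex_integer_polygon P \<and>
     (\<forall>v. v extreme_point_of P \<longrightarrow> codes X (P - {v}) {v})"

definition polygonal :: "'a set \<Rightarrow> 'a config set \<Rightarrow> bool" where
  "polygonal A X \<longleftrightarrow> subshift A X \<and> infinite X \<and> (\<exists>P. coding_polygon X P)"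

definition triangular :: "'a set \<Rightarrow> 'a config set \<Rightarrow> bool" where
  "triangular A X \<longleftrightarrow> subshift A X \<and> infinite X \<and> (\<exists>P. coding_polygon X P \<and> 2 simplex P)"

section \<open>Minimal recoding polygons\<close>

text \<open>Edges are oriented so that the polygon lies to their left. A nondegenerate edge thus occurs
  with exactly one orientation, while a segment, regarded as a polygon, has two edges.\<close>

definition oriented_edges ::
    "(real \<times> real) set \<Rightarrow> ((real \<times> real) \<times> (real \<times> real)) set" where
  "oriented_edges P = {(a, b). closed_segment a b edge_of P \<and>
     (\<forall>p\<in>P. 0 \<le> fst (b - a) * snd (p - a) - snd (b - a) * fst (p - a))}"

definition num_edges :: "(real \<times> real) set \<Rightarrow> nat" where
  "num_edges P = card (oriented_edges P)"

text \<open>Every finite alphabet is in bijection with a finite set of natural numbers, so recodings over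
  such sets already yield all coding polygons of all recodings (including those of \<open>X\<close> itself).\<close>

definition recoding_polygons :: "'a set \<Rightarrow> 'a config set \<Rightarrow> (real \<times> real) set set" where
  "recoding_polygons A X =
     {P. \<exists>(B :: nat set) Y. recoding A X B Y \<and> coding_polygon Y P}"

definition minimal_recoding_polygon ::
    "'a set \<Rightarrow> 'a config set \<Rightarrow> (real \<times> real) set \<Rightarrow> bool" where
  "minimal_recoding_polygon A X P \<longleftrightarrow> P \<in> recoding_polygons A X \<and>
     (\<forall>Q \<in> recoding_polygons A X. num_edges P \<le> num_edges Q) \<and>
     (\<forall>Q \<in> recoding_polygons A X. num_edges Q = num_edges P \<longrightarrow> Q \<subseteq> P \<longrightarrow> Q = P)"

text \<open>As usual for convex bodies, the ratio of a homothety is positive: homothetic polygons have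
  parallel edges with the same orientations.\<close>

definition homothetic :: "'v::real_vector set \<Rightarrow> 'v set \<Rightarrow> bool" where
  "homothetic P Q \<longleftrightarrow> (\<exists>c>0. \<exists>t. Q = (\<lambda>p. t + c *\<^sub>R p) ` P)"

definition differ_by_translation :: "'v::real_vector set \<Rightarrow> 'v set \<Rightarrow> bool" where
  "differ_by_translation P Q \<longleftrightarrow> (\<exists>t. Q = (\<lambda>p. t + p) ` P)"

end

theory Submission
  imports Defs
begin

text \<open>
  For homothetic polygons the idea is to move one into the other. Let \<open>Q = t + c P\<close>; by symmetry
  \<open>c \<le> 1\<close>. A vertex of \<open>P\<close> and the corresponding vertex of \<open>Q\<close> are lattice points, so \<open>Q\<close> can be
  translated by a lattice vector until they coincide. By shift invariance the translate is again
  a coding polygon of a recoding, it has as many edges as \<open>Q\<close>, hence as \<open>P\<close>, and it lies in \<open>P\<close>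
  because \<open>P\<close> is convex. Minimality of \<open>P\<close> makes it equal to \<open>P\<close>
  (\<open>translate_of_smaller_homothetic_minimal\<close>).

  If \<open>X\<close> has a coding triangle \<open>T\<close>, it remains to see that any two minimal recoding polygons are
  homothetic. The main point, \<open>triangle_edge_direction_in_recoding\<close>, is that every coding polygon \<open>P\<close>
  of a recoding of \<open>X\<close> has an oriented edge in the direction of each oriented edge \<open>vw\<close> of \<open>T\<close>.
  Suppose not. Then \<open>P\<close> has a single vertex extreme in the outer normal direction of \<open>vw\<close>; call this
  direction up. Undoing the recoding, a finite set of positions strictly below the origin
  \<open>X\<close>-codes the origin. Let \<open>C\<close> be the cone, with apex the third vertex \<open>u\<close>, spanned by \<open>T\<close>. The rows
  of \<open>C\<close> parallel to \<open>vw\<close> are coded one after the other by the rows below them: positions far from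
  the sides of \<open>C\<close> by that finite set, and then the positions near the two sides, towards the
  sides, by copies of \<open>T\<close> having their vertex \<open>v\<close> or \<open>w\<close> there (\<open>cone_fills\<close>). So a finite part of
  \<open>C\<close> codes all of \<open>C\<close>. Translates of \<open>C\<close> contain every finite set, which bounds the number of
  elements of \<open>X\<close> (\<open>finite_if_corners_and_lower_set_code\<close>); but \<open>X\<close> is infinite.

  Now let \<open>P\<close> be a minimal recoding polygon. It has at most three edges, since \<open>T\<close> itself belongs
  to the competing class, and at least one in each of the three directions of \<open>T\<close>. So these are all
  its edges, and \<open>P\<close>, being the intersection of the half-planes of its edges, is a triangle with
  sides parallel to those of \<open>T\<close> and equally oriented. Any two such triangles are homothetic.
\<close>

section \<open>Determinants in the plane\<close>

text \<open>The signed area of the parallelogram spanned by two vectors. It is used over the integers for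
  lattice positions and over the reals for points of polygons.\<close>

definition det2 :: "'r::comm_ring \<times> 'r \<Rightarrow> 'r \<times> 'r \<Rightarrow> 'r" where
  "det2 a b = fst a * snd b - snd a * fst b"

lemma det2_add_left: "det2 (a + b) c = det2 a c + det2 b c"
  and det2_add_right: "det2 c (a + b) = det2 c a + det2 c b"
  and det2_diff_left: "det2 (a - b) c = det2 a c - det2 b c"
  and det2_diff_right: "det2 c (a - b) = det2 c a - det2 c b"
  and det2_self: "det2 a a = 0"
  by (auto simp: det2_def algebra_simps)

lemma det2_scaleR_left: "det2 (c *\<^sub>R d) x = c * det2 (d :: real \<times> real) x"
  and det2_scaleR_right: "det2 d (c *\<^sub>R x) = c * det2 (d :: real \<times> real) x"
  by (auto simp: det2_def algebra_simps)

lemma linear_det2: "linear (det2 (d :: real \<times> real))"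
  by (rule linearI) (auto simp: det2_def algebra_simps)

lemma det2_eq_inner: "det2 d x = (- snd d, fst d) \<bullet> (x :: real \<times> real)"
  by (simp add: det2_def inner_prod_def)

lemma det2_cramer:
  fixes a b p :: "'r::comm_ring \<times> 'r"
  shows "det2 a b * fst p = det2 p b * fst a + det2 a p * fst b"
    and "det2 a b * snd p = det2 p b * snd a + det2 a p * snd b"
  by (auto simp: det2_def algebra_simps)

lemma det2_coordinates_inject:
  fixes a b p q :: "'r::idom \<times> 'r"
  assumes "det2 a b \<noteq> 0" "det2 p b = det2 q b" "det2 a p = det2 a q"
  shows "p = q"
proof -
  have "det2 a b * fst p = det2 a b * fst q" "det2 a b * snd p = det2 a b * snd q"
    using assms det2_cramer[of a b p] det2_cramer[of a b q] by auto
  then show ?thesis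
    using assms(1) by (simp add: prod_eq_iff)
qed

lemma det2_real_eq_0:
  fixes d x :: "real \<times> real"
  assumes "d \<noteq> 0" "det2 d x = 0"
  obtains c where "x = c *\<^sub>R d"
proof -
  have e: "fst d * snd x = snd d * fst x" using assms by (simp add: det2_def)
  show ?thesis
  proof (cases "fst d = 0")
    case True
    then have "snd d \<noteq> 0" using assms(1) by (simp add: prod_eq_iff)
    with True e show ?thesis by (intro that[of "snd x / snd d"]) (simp add: prod_eq_iff)
  next
    case False
    with e show ?thesis by (intro that[of "fst x / fst d"]) (simp add: prod_eq_iff field_simps)
  qed
qed

lemma ccw_affine_independent:
  assumes "0 < det2 (v - u) (w - u :: real \<times> real)"
  shows "\<not> affine_dependent {u, v, w}"
proof
  assume "affine_dependent {u, v, w}"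
  then have "collinear {u, v, w}" by (simp add: collinear_3_eq_affine_dependent)
  then obtain e where e: "\<And>x y. x \<in> {u, v, w} \<Longrightarrow> y \<in> {u, v, w} \<Longrightarrow> \<exists>c. x - y = c *\<^sub>R e"
    unfolding collinear_def by blast
  obtain r s where "v - u = r *\<^sub>R e" "w - u = s *\<^sub>R e" using e[of v u] e[of w u] by auto
  then show False using assms by (simp add: det2_scaleR_left det2_scaleR_right det2_self)
qed

lemma triangle_det2_bounds:
  fixes u v w x :: "real \<times> real"
  assumes "0 < det2 (v - u) (w - u)" "x \<in> convex hull {u, v, w}"
  shows "0 \<le> det2 (x - u) (w - u)" "0 \<le> det2 (v - u) (x - u)"
    "det2 (x - u) (w - u) + det2 (v - u) (x - u) \<le> det2 (v - u) (w - u)"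
proof -
  obtain r s t where x: "0 \<le> r" "0 \<le> s" "0 \<le> t" "r + s + t = 1" "x = r *\<^sub>R u + s *\<^sub>R v + t *\<^sub>R w"
    using assms(2) by (auto simp: convex_hull_3)
  have r: "r = 1 - s - t" using x by simp
  have "x - u = s *\<^sub>R (v - u) + t *\<^sub>R (w - u)"
    unfolding x(5) r by (simp add: algebra_simps)
  then have "det2 (x - u) (w - u) = s * det2 (v - u) (w - u)"
    "det2 (v - u) (x - u) = t * det2 (v - u) (w - u)"
    by (simp_all add: det2_add_left det2_add_right det2_scaleR_left det2_scaleR_right det2_self)
  moreover have "(s + t) * det2 (v - u) (w - u) \<le> 1 * det2 (v - u) (w - u)"
    using x assms by (intro mult_right_mono) auto
  ultimately show "0 \<le> det2 (x - u) (w - u)" "0 \<le> det2 (v - u) (x - u)"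
    "det2 (x - u) (w - u) + det2 (v - u) (x - u) \<le> det2 (v - u) (w - u)"
    using x(1-3) assms(1) unfolding distrib_right by simp_all
qed

section \<open>Filling a cone row by row\<close>

text \<open>The functions \<open>A\<close> and \<open>B\<close> are coordinates in which the cone is the quadrant \<open>0 \<le> A\<close>, \<open>0 \<le> B\<close>, and
  \<open>A + B\<close> is the height. A position whose two coordinates are at least \<open>M\<close> is known by assumption
  \<open>above\<close>, since everything used there lies in the cone below it. The others on this side of the row
  have small \<open>B\<close>; they are reached by decreasing \<open>B\<close>, because assumption \<open>corner\<close> uses only lower rows and
  positions of the same row with larger \<open>B\<close>. It uses values of \<open>A\<close> smaller by at most \<open>D\<close>; this stays in
  the region \<open>M \<le> A\<close> because \<open>A\<close> is large when \<open>B\<close> is small in a row of height above \<open>D + 2 * M\<close>.\<close>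

lemma row_fills:
  fixes A B :: "'p \<Rightarrow> int"
  assumes inj: "\<And>p q. A p = A q \<Longrightarrow> B p = B q \<Longrightarrow> p = q"
    and corner: "\<And>p. (\<And>q. A p - D \<le> A q \<Longrightarrow> B p \<le> B q \<Longrightarrow> A q + B q \<le> A p + B p
                   \<Longrightarrow> q \<noteq> p \<Longrightarrow> q \<in> E) \<Longrightarrow> p \<in> E"
    and above: "\<And>p. (\<And>q. A p - M \<le> A q \<Longrightarrow> B p - M \<le> B q \<Longrightarrow> A q + B q < A p + B p
                   \<Longrightarrow> q \<in> E) \<Longrightarrow> p \<in> E"
    and M: "0 \<le> M" and t: "D + 2 * M < t"
    and lower: "\<And>q. 0 \<le> A q \<Longrightarrow> 0 \<le> B q \<Longrightarrow> A q + B q < t \<Longrightarrow> q \<in> E"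
  shows "M \<le> A p \<Longrightarrow> 0 \<le> B p \<Longrightarrow> A p + B p = t \<Longrightarrow> p \<in> E"
proof (induction "nat (M - B p)" arbitrary: p rule: less_induct)
  case less
  show ?case
  proof (cases "M \<le> B p")
    case True
    show ?thesis
    proof (rule above, rule lower)
      fix q assume "A p - M \<le> A q" "B p - M \<le> B q" "A q + B q < A p + B p"
      then show "0 \<le> A q" "0 \<le> B q" "A q + B q < t" using True less.prems by auto
    qed
  next
    case False
    show ?thesis
    proof (rule corner)
      fix q assume q: "A p - D \<le> A q" "B p \<le> B q" "A q + B q \<le> A p + B p" "q \<noteq> p"
      have Aq: "M \<le> A q" using q False less.prems t by linarith
      show "q \<in> E"
      proof (cases "A q + B q = t")
        case True
        have "B q \<noteq> B p" using inj[of q p] True q less.prems by auto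
        then show ?thesis
          using less.hyps[of q] Aq True q less.prems False by auto
      next
        case False
        then show ?thesis using lower[of q] Aq M q less.prems by auto
      qed
    qed
  qed
qed

text \<open>In a row of height at least \<open>2 * M\<close> each position has one coordinate at least \<open>M\<close>, so the two
  symmetric uses of \<open>row_fills\<close> cover the row.\<close>

lemma cone_fills:
  fixes A B :: "'p \<Rightarrow> int"
  assumes inj: "\<And>p q. A p = A q \<Longrightarrow> B p = B q \<Longrightarrow> p = q"
    and corner_A: "\<And>p. (\<And>q. A p - D \<le> A q \<Longrightarrow> B p \<le> B q \<Longrightarrow> A q + B q \<le> A p + B p
                   \<Longrightarrow> q \<noteq> p \<Longrightarrow> q \<in> E) \<Longrightarrow> p \<in> E"
    and corner_B: "\<And>p. (\<And>q. A p \<le> A q \<Longrightarrow> B p - D \<le> B q \<Longrightarrow> A q + B q \<le> A p + B p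
                   \<Longrightarrow> q \<noteq> p \<Longrightarrow> q \<in> E) \<Longrightarrow> p \<in> E"
    and above: "\<And>p. (\<And>q. A p - M \<le> A q \<Longrightarrow> B p - M \<le> B q \<Longrightarrow> A q + B q < A p + B p
                   \<Longrightarrow> q \<in> E) \<Longrightarrow> p \<in> E"
    and MD: "0 \<le> M" "0 \<le> D"
    and base: "\<And>q. 0 \<le> A q \<Longrightarrow> 0 \<le> B q \<Longrightarrow> A q + B q \<le> D + 2 * M \<Longrightarrow> q \<in> E"
  shows "0 \<le> A p \<Longrightarrow> 0 \<le> B p \<Longrightarrow> p \<in> E"
proof (induction "nat (A p + B p)" arbitrary: p rule: less_induct)
  case less
  define t where "t = A p + B p"
  have lower: "q \<in> E" if "0 \<le> A q" "0 \<le> B q" "A q + B q < t" for q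
    using less.hyps[of q] that by (auto simp: t_def)
  show ?case
  proof (cases "t \<le> D + 2 * M")
    case True
    then show ?thesis using base less.prems by (simp add: t_def)
  next
    case False
    then have big: "D + 2 * M < t" by simp
    then consider "M \<le> A p" | "M \<le> B p" using MD unfolding t_def by linarith
    then show ?thesis
    proof cases
      case 1
      show ?thesis
        by (rule row_fills[of A B D E M t, OF inj corner_A above MD(1) big lower 1 less.prems(2)])
          (simp_all add: t_def)
    next
      case 2
      have corner_B': "p \<in> E"
        if "\<And>q. B p - D \<le> B q \<Longrightarrow> A p \<le> A q \<Longrightarrow> B q + A q \<le> B p + A p \<Longrightarrow> q \<noteq> p \<Longrightarrow> q \<in> E" for p
        by (rule corner_B, rule that) simp_all
      have above': "p \<in> E"
        if "\<And>q. B p - M \<le> B q \<Longrightarrow> A p - M \<le> A q \<Longrightarrow> B q + A q < B p + A p \<Longrightarrow> q \<in> E" for p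
        by (rule above, rule that) simp_all
      have lower': "q \<in> E" if "0 \<le> B q" "0 \<le> A q" "B q + A q < t" for q
        using lower[of q] that by simp
      show ?thesis
        by (rule row_fills[of B A D E M t, OF inj corner_B' above' MD(1) big lower' 2 less.prems(1)])
          (simp_all add: t_def)
    qed
  qed
qed

text \<open>The first two coding assumptions say that the lattice triangle with vertices \<open>0\<close>, \<open>a\<close>, \<open>b\<close> codes
  its corners \<open>a\<close> and \<open>b\<close>; the functional \<open>q \<mapsto> det2 q b + det2 a q\<close> is the height in the direction normal
  to the side \<open>ab\<close>. The cone at \<open>0\<close> spanned by \<open>a\<close> and \<open>b\<close> is then coded by the finite set \<open>S\<close> of its
  positions of bounded height. Finitely many elements of \<open>X\<close> are told apart by a finite set of
  positions, which a shift moves into the cone; so after this shift they are told apart on \<open>S\<close>,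
  where only \<open>card (S \<rightarrow>\<^sub>E \<A>)\<close> patterns exist.\<close>

lemma finite_if_corners_and_lower_set_code:
  fixes X :: "'a config set" and a b :: "int \<times> int"
  assumes fin: "finite \<A>" and vals: "\<And>x p. x \<in> X \<Longrightarrow> x p \<in> \<A>"
    and shift: "\<And>u x. x \<in> X \<Longrightarrow> shift u x \<in> X"
    and pos: "0 < det2 a b"
    and code_a: "\<And>x x'. x \<in> X \<Longrightarrow> x' \<in> X \<Longrightarrow>
       (\<And>q. 0 \<le> det2 q b \<Longrightarrow> 0 \<le> det2 a q \<Longrightarrow> det2 q b + det2 a q \<le> det2 a b \<Longrightarrow> q \<noteq> a
          \<Longrightarrow> x q = x' q) \<Longrightarrow> x a = x' a"
    and code_b: "\<And>x x'. x \<in> X \<Longrightarrow> x' \<in> X \<Longrightarrow>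
       (\<And>q. 0 \<le> det2 q b \<Longrightarrow> 0 \<le> det2 a q \<Longrightarrow> det2 q b + det2 a q \<le> det2 a b \<Longrightarrow> q \<noteq> b
          \<Longrightarrow> x q = x' q) \<Longrightarrow> x b = x' b"
    and G: "finite G" "\<And>g. g \<in> G \<Longrightarrow> det2 g b + det2 a g < 0"
    and code_G: "\<And>x x'. x \<in> X \<Longrightarrow> x' \<in> X \<Longrightarrow> (\<And>g. g \<in> G \<Longrightarrow> x g = x' g) \<Longrightarrow> x 0 = x' 0"
  shows "finite X"
proof -
  define A B where "A = (\<lambda>p. det2 p b)" and "B = (\<lambda>p. det2 a p)"
  have det2_AB: "det2 p b = A p" "det2 a p = B p" for p
    by (simp_all add: A_def B_def)
  define D where "D = det2 a b"
  define M where "M = Max (insert 0 ((\<lambda>g. max \<bar>A g\<bar> \<bar>B g\<bar>) ` G))"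
  have M: "0 \<le> M" "\<And>g. g \<in> G \<Longrightarrow> \<bar>A g\<bar> \<le> M \<and> \<bar>B g\<bar> \<le> M"
  proof -
    show "0 \<le> M" unfolding M_def by (rule Max_ge) (use G in auto)
    fix g assume "g \<in> G"
    then have "max \<bar>A g\<bar> \<bar>B g\<bar> \<le> M" unfolding M_def by (intro Max_ge) (use G in auto)
    then show "\<bar>A g\<bar> \<le> M \<and> \<bar>B g\<bar> \<le> M" by auto
  qed
  have add: "A (p + q) = A p + A q" "A (p - q) = A p - A q"
            "B (p + q) = B p + B q" "B (p - q) = B p - B q" for p q
    by (simp_all add: A_def B_def det2_add_left det2_add_right det2_diff_left det2_diff_right)
  have AB: "A a = D" "B a = 0" "A b = 0" "B b = D"
    by (simp_all add: A_def B_def D_def det2_self)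
  have inj: "p = q" if "A p = A q" "B p = B q" for p q
    using that pos det2_coordinates_inject[of a b p q] by (simp add: A_def B_def)
  define S where "S = {q. 0 \<le> A q \<and> 0 \<le> B q \<and> A q + B q \<le> D + 2 * M}"
  have cone: "x p = x' p" 
    if x: "x \<in> X" "x' \<in> X" and S: "\<And>q. q \<in> S \<Longrightarrow> x q = x' q" and p: "0 \<le> A p" "0 \<le> B p" for x x' p
  proof -
    have "p \<in> {q. x q = x' q}"
    proof (rule cone_fills[of A B D _ M])
      fix p 
      assume *: "\<And>q. A p - D \<le> A q \<Longrightarrow> B p \<le> B q \<Longrightarrow> A q + B q \<le> A p + B p
                   \<Longrightarrow> q \<noteq> p \<Longrightarrow> q \<in> {q. x q = x' q}"
      have "shift (p - a) x a = shift (p - a) x' a"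
      proof (rule code_a[of "shift (p - a) x" "shift (p - a) x'"])
        fix q assume "0 \<le> det2 q b" "0 \<le> det2 a q" "det2 q b + det2 a q \<le> det2 a b" "q \<noteq> a"
        then show "shift (p - a) x q = shift (p - a) x' q"
          using *[of "p - a + q"] by (simp add: shift_def add AB det2_AB algebra_simps)
      qed (intro shift x)+
      then show "p \<in> {q. x q = x' q}" by (simp add: shift_def)
    next
      fix p 
      assume *: "\<And>q. A p \<le> A q \<Longrightarrow> B p - D \<le> B q \<Longrightarrow> A q + B q \<le> A p + B p
                   \<Longrightarrow> q \<noteq> p \<Longrightarrow> q \<in> {q. x q = x' q}"
      have "shift (p - b) x b = shift (p - b) x' b"
      proof (rule code_b[of "shift (p - b) x" "shift (p - b) x'"])
        fix q assume "0 \<le> det2 q b" "0 \<le> det2 a q" "det2 q b + det2 a q \<le> det2 a b" "q \<noteq> b"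
        then show "shift (p - b) x q = shift (p - b) x' q"
          using *[of "p - b + q"] by (simp add: shift_def add AB det2_AB algebra_simps)
      qed (intro shift x)+
      then show "p \<in> {q. x q = x' q}" by (simp add: shift_def)
    next
      fix p
      assume *: "\<And>q. A p - M \<le> A q \<Longrightarrow> B p - M \<le> B q \<Longrightarrow> A q + B q < A p + B p
                   \<Longrightarrow> q \<in> {q. x q = x' q}"
      have "shift p x 0 = shift p x' 0"
      proof (rule code_G[of "shift p x" "shift p x'"])
        fix g assume g: "g \<in> G"
        then have "A g + B g < 0" using G by (simp add: A_def B_def)
        moreover have "- M \<le> A g" "- M \<le> B g" using M(2)[OF g] by auto
        ultimately show "shift p x g = shift p x' g"
          using *[of "p + g"] by (simp add: shift_def add)
      qed (intro shift x)+
      then show "p \<in> {q. x q = x' q}" by (simp add: shift_def)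
    next
      show "0 \<le> D" using pos by (simp add: D_def)
      show "q \<in> {q. x q = x' q}" if "0 \<le> A q" "0 \<le> B q" "A q + B q \<le> D + 2 * M" for q
        using S[of q] that by (simp add: S_def)
    qed (fact inj M(1) p)+
    then show ?thesis by simp
  qed
  have finS: "finite S"
  proof (rule finite_imageD)
    show "finite ((\<lambda>q. (A q, B q)) ` S)"
      by (rule finite_subset[of _ "{0..D + 2 * M} \<times> {0..D + 2 * M}"]) (auto simp: S_def)
    show "inj_on (\<lambda>q. (A q, B q)) S" using inj by (auto simp: inj_on_def)
  qed
  show ?thesis
  proof (rule finite_if_finite_subsets_card_bdd[THEN conjunct1])
    fix Z assume Z: "Z \<subseteq> X" "finite Z"
    define d where "d = (\<lambda>(z, z'). SOME p :: int \<times> int. z p \<noteq> (z' p :: 'a))"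
    have d: "z (d (z, z')) \<noteq> z' (d (z, z'))" if "z \<noteq> z'" for z z'
    proof -
      have "\<exists>p. z p \<noteq> z' p" using that by blast
      then show ?thesis unfolding d_def prod.case by (rule someI_ex)
    qed
    define N where "N = Max (insert 0 ((\<lambda>p. max \<bar>A p\<bar> \<bar>B p\<bar>) ` d ` (Z \<times> Z)))"
    have N: "\<bar>A p\<bar> \<le> N \<and> \<bar>B p\<bar> \<le> N" if "p \<in> d ` (Z \<times> Z)" for p
    proof -
      have "max \<bar>A p\<bar> \<bar>B p\<bar> \<le> N" unfolding N_def
        by (intro Max_ge insertI2 imageI that) (simp add: Z)
      then show ?thesis by auto
    qed
    \<comment> \<open>Shifting far backwards along \<open>a + b\<close> increases both cone coordinates of every position.\<close>
    define u :: "int \<times> int" where "u = - (N * fst (a + b), N * snd (a + b))"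
    have u: "A u = - N * D" "B u = - N * D"
      by (simp_all add: u_def A_def B_def D_def det2_def algebra_simps)
    define r where "r = (\<lambda>z :: 'a config. restrict (shift u z) S)"
    have "inj_on r Z"
    proof (rule inj_onI, rule ccontr)
      fix z z' assume z: "z \<in> Z" "z' \<in> Z" "r z = r z'" "z \<noteq> z'"
      define p where "p = d (z, z')"
      have Np: "\<bar>A p\<bar> \<le> N" "\<bar>B p\<bar> \<le> N" using N[of p] z(1,2) by (simp_all add: p_def)
      have "0 \<le> N" using Np by linarith
      then have "N * 1 \<le> N * D" using pos by (intro mult_left_mono) (auto simp: D_def)
      then have *: "0 \<le> A (p - u)" "0 \<le> B (p - u)" using Np unfolding add u by linarith+
      have "shift u z (p - u) = shift u z' (p - u)"
      proof (rule cone[OF _ _ _ *])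
        show "shift u z \<in> X" "shift u z' \<in> X" using z(1,2) Z(1) by (blast intro: shift)+
        show "shift u z q = shift u z' q" if "q \<in> S" for q
          using z(3) that unfolding r_def by (metis restrict_apply')
      qed
      then show False using d[OF z(4)] by (simp add: shift_def p_def)
    qed
    then show "card Z \<le> card (S \<rightarrow>\<^sub>E \<A>)"
    proof (rule card_inj_on_le)
      show "r ` Z \<subseteq> S \<rightarrow>\<^sub>E \<A>"
      proof (rule image_subsetI, unfold r_def, rule restrict_PiE_iff[THEN iffD2], rule ballI)
        fix z q assume "z \<in> Z"
        then have "z \<in> X" using Z(1) by blast
        then show "shift u z q \<in> \<A>" by (intro vals shift)
      qed
      show "finite (S \<rightarrow>\<^sub>E \<A>)" using finS fin by (simp add: finite_PiE)
    qed
  qed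
qed

section \<open>Oriented edges\<close>

lemma oriented_edges_det2:
  "(a, b) \<in> oriented_edges P \<longleftrightarrow> closed_segment a b edge_of P \<and> (\<forall>p\<in>P. 0 \<le> det2 (b - a) (p - a))"
  by (simp add: oriented_edges_def det2_def)

lemma aff_dim_closed_segment: "aff_dim (closed_segment a b) = (if a = b then 0 else 1)"
  for a b :: "'v::euclidean_space"
  by (simp add: segment_convex_hull aff_dim_convex_hull aff_dim_2)

text \<open>A supporting line that meets a polytope in more than one point meets it in an edge. As \<open>P\<close> lies to
  the left of the line with direction \<open>d\<close>, this edge is traversed in direction \<open>d\<close>.\<close>

lemma supporting_line_oriented_edge:
  fixes P :: "(real \<times> real) set"
  assumes P: "polytope P" and d: "d \<noteq> 0" and m: "\<And>x. x \<in> P \<Longrightarrow> m \<le> det2 d x"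
    and yz: "y \<in> P" "z \<in> P" "det2 d y = m" "det2 d z = m" "y \<noteq> z"
  obtains p q \<mu> where "(p, q) \<in> oriented_edges P" "\<mu> > 0" "q - p = \<mu> *\<^sub>R d" "det2 d p = m"
proof -
  define E where "E = P \<inter> {x. (- snd d, fst d) \<bullet> x = m}"
  have E: "x \<in> E \<longleftrightarrow> x \<in> P \<and> det2 d x = m" for x by (auto simp: E_def det2_eq_inner)
  have face: "E face_of P"
    unfolding E_def
    by (rule face_of_Int_supporting_hyperplane_ge)
       (use m polytope_imp_convex[OF P] in \<open>auto simp flip: det2_eq_inner\<close>)
  have col: "collinear E"
    unfolding collinear_def
  proof (intro exI[of _ d] ballI)
    fix x y assume "x \<in> E" "y \<in> E"
    then have "det2 d (x - y) = 0" by (simp add: E det2_diff_right)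
    then show "\<exists>c. x - y = c *\<^sub>R d" by (metis d det2_real_eq_0)
  qed
  have "polytope E" using face_of_polytope_polytope[OF P face] .
  then obtain p q where pq: "E = closed_segment p q"
    using compact_convex_collinear_segment[OF _ _ _ col] yz E polytope_imp_compact polytope_imp_convex
    by (metis empty_iff)
  have ne: "p \<noteq> q" using pq yz E[of y] E[of z] by auto
  have edge: "closed_segment p q edge_of P"
    using face ne by (simp add: edge_of_def pq aff_dim_closed_segment)
  have pqE: "det2 d p = m" "det2 d q = m" using E[of p] E[of q] by (auto simp: pq)
  obtain c where c: "q - p = c *\<^sub>R d"
    using det2_real_eq_0[OF d, of "q - p"] pqE by (auto simp: det2_diff_right)
  with ne have "c \<noteq> 0" by auto
  then consider "c > 0" | "c < 0" by linarith
  then show ?thesis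
  proof cases
    case 1
    have "(p, q) \<in> oriented_edges P"
      unfolding oriented_edges_det2 c using edge 1 m pqE
      by (auto simp: det2_scaleR_left det2_diff_right)
    then show ?thesis using that[of p q c] c 1 pqE by blast
  next
    case 2
    have c': "p - q = (- c) *\<^sub>R d" using c by (simp add: algebra_simps)
    have "(q, p) \<in> oriented_edges P"
      unfolding oriented_edges_det2 c' using edge 2 m pqE
      by (auto simp: det2_scaleR_left det2_diff_right closed_segment_commute
            intro!: mult_nonpos_nonpos simp del: scaleR_minus_left)
    then show ?thesis using that[of q p "-c"] c' 2 pqE by auto
  qed
qed

text \<open>Finiteness matters because \<open>num_edges\<close>, being a cardinality, would be \<open>0\<close> for an infinite set.\<close>

lemma finite_oriented_edges:
  assumes "polytope P"
  shows "finite (oriented_edges P)"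
proof -
  have "{v. v extreme_point_of P} \<times> {v. v extreme_point_of P} \<supseteq> oriented_edges P"
  proof (rule subsetI)
    fix e assume "e \<in> oriented_edges P"
    then obtain a b where e: "e = (a, b)" "closed_segment a b face_of P"
      by (cases e) (auto simp: oriented_edges_det2 edge_of_def)
    have "a extreme_point_of P" "b extreme_point_of P"
      using extreme_point_of_face[OF e(2), of a] extreme_point_of_face[OF e(2), of b]
      by (simp_all add: extreme_point_of_segment)
    then show "e \<in> {v. v extreme_point_of P} \<times> {v. v extreme_point_of P}" by (simp add: e)
  qed
  then show ?thesis
    using finite_polyhedron_extreme_points[OF polytope_imp_polyhedron[OF assms]]
    by (meson finite_SigmaI finite_subset)
qed

text \<open>Of the six ordered pairs of vertices only the three counterclockwise ones are oriented edges.\<close>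

lemma ccw_triangle_num_edges_le:
  fixes u v w :: "real \<times> real"
  assumes pos: "0 < det2 (v - u) (w - u)"
  shows "num_edges (convex hull {u, v, w}) \<le> 3"
proof -
  define T where "T = convex hull {u, v, w}"
  have sub: "{u, v, w} \<subseteq> T" by (simp add: T_def hull_subset)
  have "oriented_edges T \<subseteq> {(u, v), (v, w), (w, u)}"
  proof (rule subsetI)
    fix e assume "e \<in> oriented_edges T"
    then obtain a b where e: "e = (a, b)" "closed_segment a b face_of T" "aff_dim (closed_segment a b) = 1"
        "\<And>p. p \<in> T \<Longrightarrow> 0 \<le> det2 (b - a) (p - a)"
      by (cases e) (auto simp: oriented_edges_det2 edge_of_def)
    have "a \<noteq> b" using e(3) by auto
    have "a extreme_point_of T" "b extreme_point_of T"
      using extreme_point_of_face[OF e(2), of a] extreme_point_of_face[OF e(2), of b]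
      by (simp_all add: extreme_point_of_segment)
    then have ab: "a \<in> {u, v, w}" "b \<in> {u, v, w}"
      by (simp_all add: T_def extreme_point_of_convex_hull_affine_independent ccw_affine_independent[OF pos])
    have "0 \<le> det2 (b - a) (u - a)" "0 \<le> det2 (b - a) (v - a)" "0 \<le> det2 (b - a) (w - a)"
      using e(4) sub by auto
    then have "(a, b) \<noteq> (v, u)" "(a, b) \<noteq> (w, v)" "(a, b) \<noteq> (u, w)"
      using pos by (auto simp: det2_def algebra_simps)
    then show "e \<in> {(u, v), (v, w), (w, u)}" using ab \<open>a \<noteq> b\<close> unfolding e(1) by blast
  qed
  then have "card (oriented_edges T) \<le> card {(u, v), (v, w), (w, u)}" by (rule card_mono[rotated]) simp
  also have "\<dots> \<le> 3" by (simp add: card_insert_if)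
  finally show ?thesis by (simp add: num_edges_def T_def)
qed

lemma oriented_edges_translation:
  "oriented_edges ((+) t ` P) = (\<lambda>e. (t + fst e, t + snd e)) ` oriented_edges P"
proof -
  have mono: "(t + fst e, t + snd e) \<in> oriented_edges ((+) t ` P)" if "e \<in> oriented_edges P" for t e P
  proof -
    have "closed_segment (t + fst e) (t + snd e) = (+) t ` closed_segment (fst e) (snd e)"
      by (rule closed_segment_translation)
    moreover have "closed_segment (fst e) (snd e) edge_of P \<and> (\<forall>p\<in>P. 0 \<le> det2 (snd e - fst e) (p - fst e))"
      using that oriented_edges_det2[of "fst e" "snd e" P] by simp
    ultimately show ?thesis
      by (simp add: oriented_edges_det2 edge_of_def aff_dim_translation_eq)
  qed
  show ?thesis
  proof (intro equalityI subsetI)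
    fix e assume "e \<in> oriented_edges ((+) t ` P)"
    then have "(- t + fst e, - t + snd e) \<in> oriented_edges ((+) (- t) ` (+) t ` P)"
      by (rule mono)
    then have "(- t + fst e, - t + snd e) \<in> oriented_edges P" by (simp add: image_image)
    then show "e \<in> (\<lambda>e. (t + fst e, t + snd e)) ` oriented_edges P"
      by (rule rev_image_eqI) simp
  next
    fix e assume "e \<in> (\<lambda>e. (t + fst e, t + snd e)) ` oriented_edges P"
    then show "e \<in> oriented_edges ((+) t ` P)" using mono by blast
  qed
qed

lemma num_edges_translation: "num_edges ((+) t ` P) = num_edges P"
  unfolding num_edges_def oriented_edges_translation
  by (rule card_image) (simp add: inj_on_def prod_eq_iff)

section \<open>Subshifts and recodings\<close>

lemma lattice_point_simps:
  "lattice_point (p + q) = lattice_point p + lattice_point q"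
  "lattice_point (p - q) = lattice_point p - lattice_point q"
  "det2 (lattice_point p) (lattice_point q) = of_int (det2 p q)"
  "lattice_point p = lattice_point q \<longleftrightarrow> p = q"
  by (auto simp: lattice_point_def det2_def prod_eq_iff)

lemma agree_on_lattice_singleton [simp]: "agree_on {lattice_point p} x x' \<longleftrightarrow> x p = x' p"
  unfolding agree_on_def by (metis lattice_point_simps(4) singleton_iff)

lemma finite_lattice_points_in_bounded:
  assumes "bounded P"
  shows "finite {q. lattice_point q \<in> P}"
proof -
  obtain r where r: "\<And>x. x \<in> P \<Longrightarrow> norm x \<le> r" using assms by (auto simp: bounded_iff)
  have "{q. lattice_point q \<in> P} \<subseteq> {-\<lceil>r\<rceil>..\<lceil>r\<rceil>} \<times> {-\<lceil>r\<rceil>..\<lceil>r\<rceil>}"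
  proof (clarsimp simp: lattice_point_def)
    fix i j :: int assume "(of_int i, of_int j) \<in> P"
    then have n: "norm (of_int i :: real, of_int j :: real) \<le> r" by (rule r)
    have "\<bar>of_int i :: real\<bar> \<le> r" "\<bar>of_int j :: real\<bar> \<le> r"
      using order_trans[OF norm_fst_le n] order_trans[OF norm_snd_le n] by auto
    then show "- \<lceil>r\<rceil> \<le> i \<and> i \<le> \<lceil>r\<rceil> \<and> - \<lceil>r\<rceil> \<le> j \<and> j \<le> \<lceil>r\<rceil>" by linarith
  qed
  then show ?thesis by (rule finite_subset) auto
qed

lemma subshiftD:
  assumes "subshift A X"
  shows "finite A" "x \<in> X \<Longrightarrow> x p \<in> A" "x \<in> X \<Longrightarrow> shift u x \<in> X"
  using assms closedin_subset[of "full_shift A" X]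
  unfolding subshift_def full_shift_def image_subset_iff topspace_product_topology
    topspace_discrete_topology by blast+

lemma subshift_subset_topspace: "subshift A X \<Longrightarrow> X \<subseteq> topspace (full_shift A)"
  unfolding subshift_def using closedin_subset by blast

lemma recodingE:
  assumes "recoding A X B Y" and sA: "subshift A X"
  obtains F \<Psi> where "finite F" "\<Psi> ` X = Y" "inj_on \<Psi> X"
    "\<And>u x x'. x \<in> X \<Longrightarrow> x' \<in> X \<Longrightarrow> \<Psi> x u = \<Psi> x' u \<longleftrightarrow> (\<forall>f\<in>F. x (f + u) = x' (f + u))"
proof -
  obtain F \<Psi> where *: "finite F"
    "homeomorphic_map (subtopology (full_shift A) X) (subtopology (full_shift B) Y) \<Psi>"
    "\<And>u x x'. x \<in> X \<Longrightarrow> x' \<in> X \<Longrightarrow> \<Psi> x u = \<Psi> x' u \<longleftrightarrow> (\<forall>f\<in>F. x (f + u) = x' (f + u))"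
    using assms by (auto simp: recoding_def)
  have sB: "subshift B Y" using assms(1) by (simp add: recoding_def)
  have top: "topspace (subtopology (full_shift A) X) = X" "topspace (subtopology (full_shift B) Y) = Y"
    using subshift_subset_topspace[OF sA] subshift_subset_topspace[OF sB]
    by (simp_all add: Int_absorb1)
  show ?thesis
  proof (rule that[OF *(1) _ _ *(3)])
    show "\<Psi> ` X = Y" using homeomorphic_imp_surjective_map[OF *(2)] unfolding top .
    show "inj_on \<Psi> X" using homeomorphic_imp_injective_map[OF *(2)] unfolding top .
  qed
qed

text \<open>Renaming the letters by natural numbers is a recoding with window \<open>{0}\<close>; it does not change which
  sets code which.\<close>

lemma coding_polygon_in_recoding_polygons:
  fixes X :: "'a config set"
  assumes X: "subshift A X" and P: "coding_polygon X P"
  shows "P \<in> recoding_polygons A X"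
proof -
  have "finite A" using X by (rule subshiftD(1))
  then obtain c :: "'a \<Rightarrow> nat" where c: "inj_on c A" using finite_imp_inj_to_nat_seg by blast
  define \<Psi> where "\<Psi> = (\<lambda>x :: 'a config. c \<circ> x)"
  define d where "d = inv_into A c"
  have d: "d (c i) = i" if "i \<in> A" for i using c that by (simp add: d_def)
  have valA: "x p \<in> A" if "x \<in> X" for x p using subshiftD(2)[OF X that] .
  have top: "homeomorphic_map (full_shift A) (full_shift (c ` A)) \<Psi>"
    unfolding homeomorphic_map_maps
  proof
    show "homeomorphic_maps (full_shift A) (full_shift (c ` A)) \<Psi> (\<lambda>y. d \<circ> y)"
      unfolding homeomorphic_maps_def
    proof (intro conjI ballI)
      have cont: "continuous_map (full_shift B) (full_shift C) (\<lambda>x. f \<circ> x)"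
        if f: "f ` B \<subseteq> C" for B C and f :: "'c \<Rightarrow> 'd"
        unfolding full_shift_def continuous_map_componentwise_UNIV
      proof
        fix p :: "int \<times> int"
        have "continuous_map (discrete_topology B) (discrete_topology C) f" using f by auto
        then have "continuous_map (product_topology (\<lambda>_. discrete_topology B) UNIV) (discrete_topology C) (f \<circ> (\<lambda>x. x p))"
          by (rule continuous_map_compose[OF continuous_map_product_projection, rotated]) simp
        then show "continuous_map (product_topology (\<lambda>_. discrete_topology B) UNIV) (discrete_topology C) (\<lambda>x. (f \<circ> x) p)"
          by (simp add: comp_def)
      qed
      show "continuous_map (full_shift A) (full_shift (c ` A)) \<Psi>"
        unfolding \<Psi>_def by (rule cont) simp
      show "continuous_map (full_shift (c ` A)) (full_shift A) (\<lambda>y. d \<circ> y)"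
        by (rule cont) (use d in auto)
      show "d \<circ> \<Psi> x = x" if "x \<in> topspace (full_shift A)" for x
        using that d by (auto simp: \<Psi>_def full_shift_def fun_eq_iff PiE_def)
      show "\<Psi> (d \<circ> y) = y" if "y \<in> topspace (full_shift (c ` A))" for y
      proof
        fix p
        have "y p \<in> c ` A" using that by (simp add: full_shift_def PiE_def Pi_def del: split_paired_All)
        then show "\<Psi> (d \<circ> y) p = y p" by (auto simp: \<Psi>_def d)
      qed
    qed
  qed
  have subX: "X \<subseteq> topspace (full_shift A)" by (rule subshift_subset_topspace[OF X])
  have cX: "closedin (full_shift A) X" using X unfolding subshift_def by blast
  have cY: "closedin (full_shift (c ` A)) (\<Psi> ` X)"
    using homeomorphic_map_closedness[OF top subX] cX by blast
  have shift\<Psi>: "\<Psi> (shift u x) = shift u (\<Psi> x)" for u x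
    by (simp add: \<Psi>_def shift_def comp_def)
  have \<Psi>_eq: "\<Psi> x p = \<Psi> x' p \<longleftrightarrow> x p = x' p" if "x \<in> X" "x' \<in> X" for x x' p
    using inj_on_eq_iff[OF c] valA that by (simp add: \<Psi>_def)
  have Y: "subshift (c ` A) (\<Psi> ` X)"
    unfolding subshift_def
  proof (intro conjI allI)
    show "shift u ` \<Psi> ` X \<subseteq> \<Psi> ` X" for u
      using subshiftD(3)[OF X] unfolding image_subset_iff by (metis imageE imageI shift\<Psi>)
  qed (use \<open>finite A\<close> cY in auto)
  have "recoding A X (c ` A) (\<Psi> ` X)"
    unfolding recoding_def
  proof (intro conjI exI)
    show "homeomorphic_map (subtopology (full_shift A) X) (subtopology (full_shift (c ` A)) (\<Psi> ` X)) \<Psi>"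
    proof (rule homeomorphic_map_subtopologies[OF top])
      have "\<Psi> ` X \<subseteq> topspace (full_shift (c ` A))" by (rule closedin_subset[OF cY])
      then show "\<Psi> ` (topspace (full_shift A) \<inter> X) = topspace (full_shift (c ` A)) \<inter> \<Psi> ` X"
        using subX by (simp add: Int_absorb1)
    qed
    show "finite {0 :: int \<times> int}" by simp
    show "\<forall>u. \<forall>x\<in>X. \<forall>x'\<in>X. \<Psi> x u = \<Psi> x' u \<longleftrightarrow> (\<forall>f\<in>{0}. x (f + u) = x' (f + u))"
      using \<Psi>_eq by simp
  qed (use Y shift\<Psi> in auto)
  moreover have "coding_polygon (\<Psi> ` X) P"
  proof -
    have "inj_on \<Psi> X"
    proof (intro inj_onI ext)
      fix x x' p assume "x \<in> X" "x' \<in> X" "\<Psi> x = \<Psi> x'"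
      then show "x p = x' p" using \<Psi>_eq[of x x' p] by simp
    qed
    then have "infinite (\<Psi> ` X)" using P finite_imageD unfolding coding_polygon_def by blast
    moreover have agree: "agree_on S (\<Psi> x) (\<Psi> x') \<longleftrightarrow> agree_on S x x'" if "x \<in> X" "x' \<in> X" for S x x'
      unfolding agree_on_def using \<Psi>_eq[OF that] by blast
    then have "codes (\<Psi> ` X) S T \<longleftrightarrow> codes X S T" for S T
      unfolding codes_def ball_simps by blast
    ultimately show ?thesis using P unfolding coding_polygon_def by blast
  qed
  ultimately show ?thesis unfolding recoding_polygons_def by blast
qed

lemma extreme_point_of_translation_iff:
  "v extreme_point_of ((+) t ` P) \<longleftrightarrow> (v - t) extreme_point_of P"
  using extreme_point_of_translation_eq[of t "v - t" P] by simp

lemma coding_polygon_translation: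
  assumes P: "coding_polygon X P" and X: "subshift A X"
  shows "coding_polygon X ((+) (lattice_point z) ` P)"
proof -
  let ?P = "(+) (lattice_point z) ` P"
  have poly: "convex_integer_polygon P" using P unfolding coding_polygon_def by blast
  have "v \<in> range lattice_point" if v: "v extreme_point_of ?P" for v
  proof -
    obtain p where "v - lattice_point z = lattice_point p"
      using poly v unfolding convex_integer_polygon_def extreme_point_of_translation_iff by blast
    then have "v = lattice_point (p + z)" by (simp add: lattice_point_simps algebra_simps)
    then show ?thesis by blast
  qed
  then have poly': "convex_integer_polygon ?P"
    using poly unfolding convex_integer_polygon_def polytope_translation_eq aff_dim_translation_eq by blast
  have "codes X (?P - {v}) {v}" if v: "v extreme_point_of ?P" for v
  proof -
    obtain p where p: "v = lattice_point p" using poly' v unfolding convex_integer_polygon_def by blast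
    have pz: "v - lattice_point z = lattice_point (p - z)" by (simp add: p lattice_point_simps)
    have code: "codes X (P - {lattice_point (p - z)}) {lattice_point (p - z)}"
      using P v unfolding coding_polygon_def extreme_point_of_translation_iff pz by blast
    show ?thesis
      unfolding codes_def p agree_on_lattice_singleton
    proof (intro ballI impI)
      fix x x' assume x: "x \<in> X" "x' \<in> X" and agree: "agree_on (?P - {lattice_point p}) x x'"
      have "agree_on (P - {lattice_point (p - z)}) (shift z x) (shift z x')"
        unfolding agree_on_def shift_def
      proof (intro allI impI)
        fix q assume q: "lattice_point q \<in> P - {lattice_point (p - z)}"
        then have "lattice_point (z + q) \<in> ?P - {lattice_point p}"
          by (auto simp: lattice_point_simps algebra_simps)
        with agree show "x (z + q) = x' (z + q)" unfolding agree_on_def by blast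
      qed
      then have "agree_on {lattice_point (p - z)} (shift z x) (shift z x')"
        using code x subshiftD(3)[OF X] unfolding codes_def by blast
      then show "x p = x' p" by (simp add: shift_def)
    qed
  qed
  then show ?thesis using P poly' unfolding coding_polygon_def by blast
qed

lemma recoding_polygons_translation:
  assumes "P \<in> recoding_polygons A X"
  shows "(+) (lattice_point z) ` P \<in> recoding_polygons A X"
  using assms coding_polygon_translation unfolding recoding_polygons_def recoding_def by blast

section \<open>Edge directions of a coding triangle occur in every recoding\<close>

text \<open>If \<open>P\<close> had no such edge, it would have a unique point \<open>z\<close> minimizing \<open>det2 d\<close>, where \<open>d = w - v\<close>, and
  \<open>z\<close> would be a lattice vertex coded by the rest of \<open>P\<close>. In terms of \<open>X\<close> this says that the values on
  \<open>F + q\<close>, for the other lattice points \<open>q\<close> of \<open>P\<close>, determine those on \<open>F + z\<close>. For the element \<open>f0\<close> of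
  the window \<open>F\<close> minimizing \<open>det2 d\<close>, all the positions \<open>f + q\<close> are strictly on one side of \<open>f0 + z\<close>, so
  \<open>X\<close> would be finite by \<open>finite_if_corners_and_lower_set_code\<close>.\<close>

lemma triangle_edge_direction_in_recoding:
  fixes X :: "'a config set" and Y :: "'b config set"
  assumes rec: "recoding A X B Y" and A: "subshift A X" and X: "infinite X"
    and T: "coding_polygon X (convex hull {lattice_point u, lattice_point v, lattice_point w})"
    and pos: "0 < det2 (v - u) (w - u)"
    and P: "coding_polygon Y P"
  obtains p q \<mu> where "(p, q) \<in> oriented_edges P" "\<mu> > 0" "q - p = \<mu> *\<^sub>R lattice_point (w - v)"
proof -
  define d where "d = w - v"
  have polyP: "polytope P" "P \<noteq> {}"
    using P by (auto simp: coding_polygon_def convex_integer_polygon_def)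
  have "d \<noteq> 0" using pos by (auto simp: d_def det2_self)
  then have d: "lattice_point d \<noteq> 0" using lattice_point_simps(4)[of d 0] by (simp add: lattice_point_def zero_prod_def)
  obtain v0 where v0: "v0 \<in> P" "\<And>x. x \<in> P \<Longrightarrow> det2 (lattice_point d) v0 \<le> det2 (lattice_point d) x"
    using continuous_attains_inf[OF polytope_imp_compact[OF polyP(1)] polyP(2)]
      linear_continuous_on[OF linear_conv_bounded_linear[THEN iffD1, OF linear_det2]] by metis
  show ?thesis
  proof (cases "\<exists>y\<in>P. y \<noteq> v0 \<and> det2 (lattice_point d) y = det2 (lattice_point d) v0")
    case True
    then obtain y where "y \<in> P" "y \<noteq> v0" "det2 (lattice_point d) y = det2 (lattice_point d) v0"
      by blast
    then show ?thesis
      using supporting_line_oriented_edge[OF polyP(1) d v0(2) v0(1), of y] that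
      unfolding d_def by metis
  next
    case False
    have "P \<inter> {x. (- snd (lattice_point d), fst (lattice_point d)) \<bullet> x = det2 (lattice_point d) v0} face_of P"
      by (rule face_of_Int_supporting_hyperplane_ge)
         (use v0 polytope_imp_convex[OF polyP(1)] in \<open>auto simp flip: det2_eq_inner\<close>)
    also have "P \<inter> {x. (- snd (lattice_point d), fst (lattice_point d)) \<bullet> x = det2 (lattice_point d) v0} = {v0}"
      using v0 False by (auto simp flip: det2_eq_inner)
    finally have ext: "v0 extreme_point_of P" by (simp add: face_of_singleton)
    then obtain z where z: "v0 = lattice_point z"
      using P unfolding coding_polygon_def convex_integer_polygon_def by (metis imageE)
    have strict: "det2 d z < det2 d q" if "lattice_point q \<in> P" "q \<noteq> z" for q
    proof -
      have "det2 (lattice_point d) (lattice_point z) < det2 (lattice_point d) (lattice_point q)"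
        using v0(2)[OF that(1)] False that by (force simp: z lattice_point_simps)
      then show ?thesis by (simp add: lattice_point_simps)
    qed
    have codeP: "codes Y (P - {lattice_point z}) {lattice_point z}"
      using P ext unfolding coding_polygon_def z by blast
    obtain F \<Psi> where F: "finite F" and \<Psi>: "\<Psi> ` X = Y" "inj_on \<Psi> X"
      and F\<Psi>: "\<And>u x x'. x \<in> X \<Longrightarrow> x' \<in> X \<Longrightarrow> \<Psi> x u = \<Psi> x' u \<longleftrightarrow> (\<forall>f\<in>F. x (f + u) = x' (f + u))"
      by (rule recodingE[OF rec A]) blast
    \<comment> \<open>An empty window would make \<open>\<Psi>\<close> constant, although \<open>X\<close> is infinite and \<open>\<Psi>\<close> injective.\<close>
    have "F \<noteq> {}"
    proof
      assume "F = {}"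
      have "\<Psi> x = \<Psi> x'" if "x \<in> X" "x' \<in> X" for x x'
      proof
        fix p show "\<Psi> x p = \<Psi> x' p" unfolding F\<Psi>[OF that] using \<open>F = {}\<close> by blast
      qed
      then have "X \<subseteq> {x}" if "x \<in> X" for x using \<Psi>(2) that unfolding inj_on_def by blast
      then have "finite X" by (metis finite.simps finite_subset subsetI)
      with X show False by contradiction
    qed
    \<comment> \<open>The window element whose translates lie highest, as the height is \<open>- det2 d\<close>.\<close>
    define f0 where "f0 = arg_min_on (det2 d) F"
    have f0: "f0 \<in> F" "\<And>f. f \<in> F \<Longrightarrow> det2 d f0 \<le> det2 d f"
      unfolding f0_def using arg_min_if_finite(1)[OF F \<open>F \<noteq> {}\<close>] arg_min_least[OF F \<open>F \<noteq> {}\<close>] by blast+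
    define G where "G = {f + q - (f0 + z) | f q. f \<in> F \<and> q \<in> {q. lattice_point q \<in> P} - {z}}"
    have T_ind: "\<not> affine_dependent {lattice_point u, lattice_point v, lattice_point w}"
      by (rule ccw_affine_independent) (use pos in \<open>simp add: lattice_point_simps(3) flip: lattice_point_simps(2)\<close>)
    define T where "T = convex hull {lattice_point u, lattice_point v, lattice_point w}"
    have region: "0 \<le> det2 (q - u) (w - u)" "0 \<le> det2 (v - u) (q - u)"
      "det2 (q - u) (w - u) + det2 (v - u) (q - u) \<le> det2 (v - u) (w - u)" if "lattice_point q \<in> T" for q
      using triangle_det2_bounds[of "lattice_point v" "lattice_point u" "lattice_point w" "lattice_point q"] pos that
      unfolding T_def lattice_point_simps(2)[symmetric] lattice_point_simps(3) by linarith+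
    have corner: "x (c - u) = x' (c - u)"
      if c: "c \<in> {u, v, w}" and x: "x \<in> X" "x' \<in> X" 
        and agree: "\<And>q. 0 \<le> det2 q (w - u) \<Longrightarrow> 0 \<le> det2 (v - u) q \<Longrightarrow>
           det2 q (w - u) + det2 (v - u) q \<le> det2 (v - u) (w - u) \<Longrightarrow> q \<noteq> c - u \<Longrightarrow> x q = x' q" for c x x'
    proof -
      have "lattice_point c extreme_point_of T"
        unfolding T_def extreme_point_of_convex_hull_affine_independent[OF T_ind] using c by auto
      then have "codes X (T - {lattice_point c}) {lattice_point c}"
        using T unfolding coding_polygon_def T_def by blast
      moreover have "agree_on (T - {lattice_point c}) (shift (- u) x) (shift (- u) x')"
        unfolding agree_on_def
      proof (intro allI impI)
        fix q assume "lattice_point q \<in> T - {lattice_point c}"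
        then have q: "lattice_point q \<in> T" "q \<noteq> c" by auto
        have "x (q - u) = x' (q - u)" by (rule agree) (use region[OF q(1)] q(2) in auto)
        then show "shift (- u) x q = shift (- u) x' q" by (simp add: shift_def)
      qed
      ultimately have "agree_on {lattice_point c} (shift (- u) x) (shift (- u) x')"
        using x subshiftD(3)[OF A] unfolding codes_def by blast
      then show ?thesis by (simp add: shift_def)
    qed
    have det_d: "det2 q (w - u) + det2 (v - u) q = - det2 d q" for q
      by (simp add: d_def det2_def algebra_simps)
    have "finite X"
    proof (rule finite_if_corners_and_lower_set_code[where \<A> = A and X = X and a = "v - u" and b = "w - u" and G = G])
      show "finite A" by (rule subshiftD(1)[OF A])
      show "x p \<in> A" if "x \<in> X" for x p by (rule subshiftD(2)[OF A that])
      show "shift t x \<in> X" if "x \<in> X" for t x by (rule subshiftD(3)[OF A that])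
      show "0 < det2 (v - u) (w - u)" by (rule pos)
      show "finite G" unfolding G_def
        by (rule finite_image_set2)
           (use F finite_lattice_points_in_bounded[OF polytope_imp_bounded[OF polyP(1)]] in simp_all)
      show "det2 g (w - u) + det2 (v - u) g < 0" if g: "g \<in> G" for g
      proof -
        obtain f q where "g = f + q - (f0 + z)" "f \<in> F" "lattice_point q \<in> P" "q \<noteq> z"
          using g unfolding G_def by blast
        then show ?thesis
          using f0(2)[of f] strict[of q] unfolding det_d by (simp add: det2_add_right det2_diff_right)
      qed
      show "x 0 = x' 0" if x: "x \<in> X" "x' \<in> X" and agree: "\<And>g. g \<in> G \<Longrightarrow> x g = x' g" for x x'
      proof -
        define y y' where "y = shift (- (f0 + z)) x" and "y' = shift (- (f0 + z)) x'"
        have y: "y \<in> X" "y' \<in> X" using x subshiftD(3)[OF A] by (auto simp: y_def y'_def)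
        have "agree_on (P - {lattice_point z}) (\<Psi> y) (\<Psi> y')"
          unfolding agree_on_def
        proof (intro allI impI)
          fix q assume "lattice_point q \<in> P - {lattice_point z}"
          then have q: "lattice_point q \<in> P" "q \<noteq> z" by auto
          show "\<Psi> y q = \<Psi> y' q"
            unfolding F\<Psi>[OF y]
          proof
            fix f assume "f \<in> F"
            then have "f + q - (f0 + z) \<in> G" using q unfolding G_def by blast
            from agree[OF this] show "y (f + q) = y' (f + q)"
              by (simp add: y_def y'_def shift_def algebra_simps)
          qed
        qed
        then have "agree_on {lattice_point z} (\<Psi> y) (\<Psi> y')"
          using codeP y \<Psi>(1) unfolding codes_def by blast
        then have "\<Psi> y z = \<Psi> y' z" by simp
        then have "y (f0 + z) = y' (f0 + z)" unfolding F\<Psi>[OF y] using f0(1) by blast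
        then show ?thesis by (simp add: y_def y'_def shift_def)
      qed
    next
      fix x x' assume "x \<in> X" "x' \<in> X"
        "\<And>q. 0 \<le> det2 q (w - u) \<Longrightarrow> 0 \<le> det2 (v - u) q \<Longrightarrow>
           det2 q (w - u) + det2 (v - u) q \<le> det2 (v - u) (w - u) \<Longrightarrow> q \<noteq> v - u \<Longrightarrow> x q = x' q"
      then show "x (v - u) = x' (v - u)" using corner[of v x x'] by blast
    next
      fix x x' assume "x \<in> X" "x' \<in> X"
        "\<And>q. 0 \<le> det2 q (w - u) \<Longrightarrow> 0 \<le> det2 (v - u) q \<Longrightarrow>
           det2 q (w - u) + det2 (v - u) q \<le> det2 (v - u) (w - u) \<Longrightarrow> q \<noteq> w - u \<Longrightarrow> x q = x' q"
      then show "x (w - u) = x' (w - u)" using corner[of w x x'] by blast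
    qed
    with X show ?thesis by contradiction
  qed
qed

section \<open>Polygons with three prescribed edge directions\<close>

text \<open>The three given edges are distinct and hence all edges of \<open>P\<close>. A polygon of full dimension is the
  intersection of the half-planes that support it along its edges, and each of these half-planes
  now has one of the directions \<open>d1\<close>, \<open>d2\<close>, \<open>d3\<close>. Since \<open>det2 d1 x + det2 d2 x + det2 d3 x = 0\<close> for all \<open>x\<close>,
  negativity of \<open>k1 + k2 + k3\<close> expresses that the triangle is not reduced to a point.\<close>

lemma three_edge_polygon:
  fixes P :: "(real \<times> real) set"
  assumes P: "polytope P" and card: "num_edges P \<le> 3"
    and pos: "0 < det2 d1 d2" and sum: "d1 + d2 + d3 = 0"
    and e1: "(p1, q1) \<in> oriented_edges P" "\<mu>1 > 0" "q1 - p1 = \<mu>1 *\<^sub>R d1"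
    and e2: "(p2, q2) \<in> oriented_edges P" "\<mu>2 > 0" "q2 - p2 = \<mu>2 *\<^sub>R d2"
    and e3: "(p3, q3) \<in> oriented_edges P" "\<mu>3 > 0" "q3 - p3 = \<mu>3 *\<^sub>R d3"
  obtains k1 k2 k3 where "P = {x. k1 \<le> det2 d1 x \<and> k2 \<le> det2 d2 x \<and> k3 \<le> det2 d3 x}" "k1 + k2 + k3 < 0"
proof -
  have d3: "d3 = - d1 - d2" using sum by (simp add: algebra_simps eq_neg_iff_add_eq_0 add.assoc)
  have pos': "0 < det2 d2 d3" "0 < det2 d3 d1" "0 < det2 d1 d2"
    using pos by (simp_all add: d3 det2_def algebra_simps)
  have sum0: "det2 d1 x + det2 d2 x + det2 d3 x = 0" for x by (simp add: d3 det2_def algebra_simps)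
  have edge: "closed_segment p q face_of P" "aff_dim (closed_segment p q) = 1"
      "p \<in> P" "q \<in> P" "det2 d q = det2 d p" "\<And>x. x \<in> P \<Longrightarrow> det2 d p \<le> det2 d x"
    if "(p, q) \<in> oriented_edges P" "\<mu> > 0" "q - p = \<mu> *\<^sub>R d" for p q \<mu> d
  proof -
    show f: "closed_segment p q face_of P" "aff_dim (closed_segment p q) = 1"
      using that(1) by (auto simp: oriented_edges_det2 edge_of_def)
    show "p \<in> P" "q \<in> P" using face_of_imp_subset[OF f(1)] by auto
    have "q = p + \<mu> *\<^sub>R d" using that(3) by (simp add: algebra_simps)
    then show "det2 d q = det2 d p" by (simp add: det2_add_right det2_scaleR_right det2_self)
    fix x assume "x \<in> P"
    then have "0 \<le> \<mu> * det2 d (x - p)"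
      using that(1) unfolding oriented_edges_det2 that(3) det2_scaleR_left by blast
    then show "det2 d p \<le> det2 d x"
      using that(2) by (simp add: zero_le_mult_iff det2_diff_right)
  qed
  note E1 = edge[OF e1] and E2 = edge[OF e2] and E3 = edge[OF e3]
  \<comment> \<open>Two edges of different directions force \<open>P\<close> to have dimension 2.\<close>
  have "closed_segment p1 q1 \<noteq> P"
  proof
    assume "closed_segment p1 q1 = P"
    then have "p2 \<in> closed_segment p1 q1" "q2 \<in> closed_segment p1 q1" using E2 by auto
    moreover have "det2 d1 x = det2 d1 p1" if x: "x \<in> closed_segment p1 q1" for x
    proof -
      obtain t where "x = (1 - t) *\<^sub>R p1 + t *\<^sub>R q1" using x by (auto simp: closed_segment_def)
      then have "det2 d1 x = (1 - t) * det2 d1 p1 + t * det2 d1 q1"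
        by (simp only: det2_add_right det2_scaleR_right)
      then show ?thesis unfolding E1(5) by (simp add: algebra_simps)
    qed
    ultimately have "det2 d1 q2 = det2 d1 p2" by metis
    then have "det2 d1 (q2 - p2) = 0" by (simp add: det2_diff_right)
    then show False using e2 pos by (simp add: det2_scaleR_right)
  qed
  then have "1 < aff_dim P"
    using face_of_aff_dim_lt[OF polytope_imp_convex[OF P] E1(1)] E1(2) by simp
  moreover have "aff_dim P \<le> 2" using aff_dim_le_DIM[of P] by simp
  ultimately have dim: "aff_dim P = 2" by linarith
  then have full: "affine hull P = UNIV" using aff_dim_eq_full[of P] by simp
  obtain H where H: "finite H" "P = affine hull P \<inter> \<Inter>H"
    "\<forall>h\<in>H. \<exists>a b. a \<noteq> 0 \<and> h = {x. a \<bullet> x \<le> b}" "\<forall>F'. F' \<subset> H \<longrightarrow> P \<subset> affine hull P \<inter> \<Inter>F'"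
    using polytope_imp_polyhedron[OF P] unfolding polyhedron_Int_affine_minimal by blast
  obtain a b where ab: "\<And>h. h \<in> H \<Longrightarrow> a h \<noteq> 0 \<and> h = {x. a h \<bullet> x \<le> b h}"
    using H(3) by metis
  have "(p1, q1) \<noteq> (p2, q2)" "(p1, q1) \<noteq> (p3, q3)" "(p2, q2) \<noteq> (p3, q3)"
  proof -
    have "det2 (q1 - p1) (q2 - p2) > 0" "det2 (q2 - p2) (q3 - p3) > 0" "det2 (q3 - p3) (q1 - p1) > 0"
      unfolding e1(3) e2(3) e3(3) det2_scaleR_left det2_scaleR_right
      using pos' e1(2) e2(2) e3(2) by simp_all
    then show "(p1, q1) \<noteq> (p2, q2)" "(p1, q1) \<noteq> (p3, q3)" "(p2, q2) \<noteq> (p3, q3)"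
      by (auto simp: det2_self)
  qed
  then have "card {(p1, q1), (p2, q2), (p3, q3)} = 3" by simp
  then have edges: "oriented_edges P = {(p1, q1), (p2, q2), (p3, q3)}"
    using card_seteq[OF finite_oriented_edges[OF P], of "{(p1, q1), (p2, q2), (p3, q3)}"] card e1(1) e2(1) e3(1)
    by (simp add: num_edges_def)
  define R where "R = {x. det2 d1 p1 \<le> det2 d1 x \<and> det2 d2 p2 \<le> det2 d2 x \<and> det2 d3 p3 \<le> det2 d3 x}"
  have "R \<subseteq> h" if h: "h \<in> H" for h
  proof -
    have "P \<inter> {x. a h \<bullet> x = b h} facet_of P"
      using facet_of_polyhedron_explicit[OF H(1,2) ab] H(4) h by blast
    then have "aff_dim (P \<inter> {x. a h \<bullet> x = b h}) = 1" by (simp add: facet_of_def dim)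
    then have "\<not> P \<inter> {x. a h \<bullet> x = b h} \<subseteq> {x}" for x
      using aff_dim_subset[of "P \<inter> {x. a h \<bullet> x = b h}" "{x}"] by auto
    then obtain y z where yz: "y \<in> P" "z \<in> P" "a h \<bullet> y = b h" "a h \<bullet> z = b h" "y \<noteq> z"
      by blast
    \<comment> \<open>The outer normal turned counterclockwise by a right angle: the half-plane lies to its left.\<close>
    define d where "d = (- snd (a h), fst (a h))"
    have det: "det2 d x = - (a h \<bullet> x)" for x by (simp add: d_def det2_def inner_prod_def)
    have "d \<noteq> 0" using ab[OF h] by (auto simp: d_def zero_prod_def prod_eq_iff)
    moreover have "- b h \<le> det2 d x" if "x \<in> P" for x
    proof -
      have "x \<in> h" using that H(2) h by blast
      then show ?thesis using ab[OF h] det by auto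
    qed
    moreover have "det2 d y = - b h" "det2 d z = - b h" using yz by (simp_all add: det)
    ultimately obtain p q \<mu> where pq: "(p, q) \<in> oriented_edges P" "\<mu> > 0" "q - p = \<mu> *\<^sub>R d" "det2 d p = - b h"
      using supporting_line_oriented_edge[OF P, of d "- b h" y z] yz(1,2,5) by blast
    have conclude: "x \<in> h" 
      if x: "det2 d' p' \<le> det2 d' x" and "(p, q) = (p', q')" "\<mu>' > 0" "q' - p' = \<mu>' *\<^sub>R d'" for x p' q' d' \<mu>'
    proof -
      have "0 \<le> det2 (q' - p') (x - p')"
        unfolding that(4) det2_scaleR_left using x that(3) by (simp add: det2_diff_right)
      then have "0 \<le> \<mu> * det2 d (x - p)"
        using that(2) pq(3) by (simp add: det2_scaleR_left)
      then have "- b h \<le> det2 d x" using pq(2,4) by (simp add: zero_le_mult_iff det2_diff_right)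
      then show ?thesis using ab[OF h] by (auto simp: det)
    qed
    show ?thesis
    proof
      fix x assume x: "x \<in> R"
      consider "(p, q) = (p1, q1)" | "(p, q) = (p2, q2)" | "(p, q) = (p3, q3)"
        using pq(1) unfolding edges by blast
      then show "x \<in> h"
        by cases (use x conclude[OF _ _ e1(2,3)] conclude[OF _ _ e2(2,3)] conclude[OF _ _ e3(2,3)] in
            \<open>simp_all add: R_def\<close>)
    qed
  qed
  then have "R \<subseteq> P" using H(2) full by blast
  moreover have "P \<subseteq> R" using E1(6) E2(6) E3(6) by (auto simp: R_def)
  moreover have "det2 d1 p1 + det2 d2 p2 + det2 d3 p3 < 0"
  proof -
    have "det2 d2 q1 < det2 d2 p1"
    proof -
      have "det2 d2 (q1 - p1) < 0"
        unfolding e1(3) det2_scaleR_right using e1(2) pos by (simp add: mult_pos_neg det2_def algebra_simps)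
      then show ?thesis by (simp add: det2_diff_right)
    qed
    then show ?thesis using sum0[of p1] E2(6)[OF E1(4)] E3(6)[OF E1(3)] by linarith
  qed
  ultimately show ?thesis using that R_def by blast
qed

text \<open>The ratio of the homothety is that of the sums of the bounds, and the translation is determined
  by two of the three sides; as the three functionals add up to \<open>0\<close>, the third side then matches.\<close>

lemma homothetic_triangles:
  fixes d1 d2 d3 :: "real \<times> real"
  assumes pos: "0 < det2 d1 d2" and sum: "d1 + d2 + d3 = 0"
    and P: "P = {x. k1 \<le> det2 d1 x \<and> k2 \<le> det2 d2 x \<and> k3 \<le> det2 d3 x}" "k1 + k2 + k3 < 0"
    and Q: "Q = {x. l1 \<le> det2 d1 x \<and> l2 \<le> det2 d2 x \<and> l3 \<le> det2 d3 x}" "l1 + l2 + l3 < 0"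
  shows "homothetic P Q"
proof -
  have d3: "d3 = - d1 - d2" using sum by (simp add: algebra_simps eq_neg_iff_add_eq_0 add.assoc)
  have sum0: "det2 d3 x = - det2 d1 x - det2 d2 x" for x by (simp add: d3 det2_def algebra_simps)
  define c where "c = (l1 + l2 + l3) / (k1 + k2 + k3)"
  have c: "0 < c" using P(2) Q(2) by (simp add: c_def zero_less_divide_iff)
  have csum: "c * (k1 + k2 + k3) = l1 + l2 + l3" using P(2) by (simp add: c_def)
  define t where "t = ((l1 - c * k1) / det2 d1 d2) *\<^sub>R d2 - ((l2 - c * k2) / det2 d1 d2) *\<^sub>R d1"
  have "det2 d2 d1 = - det2 d1 d2" by (simp add: det2_def)
  then have t12: "det2 d1 t = l1 - c * k1" "det2 d2 t = l2 - c * k2"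
    using pos by (simp_all add: t_def det2_diff_right det2_scaleR_right det2_self)
  have t3: "det2 d3 t = l3 - c * k3"
    using csum unfolding sum0 t12 by (simp add: algebra_simps)
  have PQ: "t + c *\<^sub>R x \<in> Q \<longleftrightarrow> x \<in> P" for x
    unfolding P(1) Q(1) using c by (simp add: det2_add_right det2_scaleR_right t12 t3)
  have "Q = (\<lambda>p. t + c *\<^sub>R p) ` P"
  proof
    show "Q \<subseteq> (\<lambda>p. t + c *\<^sub>R p) ` P"
    proof
      fix y assume y: "y \<in> Q"
      have eq: "y = t + c *\<^sub>R ((1 / c) *\<^sub>R (y - t))" using c by simp
      with y have "(1 / c) *\<^sub>R (y - t) \<in> P" using PQ by metis
      with eq show "y \<in> (\<lambda>p. t + c *\<^sub>R p) ` P" by blast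
    qed
  qed (use PQ in blast)
  with c show ?thesis unfolding homothetic_def by blast
qed

section \<open>Minimal recoding polygons\<close>

lemma homothety_inverse:
  fixes P Q :: "'v::real_vector set"
  assumes "Q = (\<lambda>p. t + c *\<^sub>R p) ` P" "c > 0"
  shows "P = (\<lambda>q. - ((1 / c) *\<^sub>R t) + (1 / c) *\<^sub>R q) ` Q"
  using assms by (simp add: image_image scaleR_add_right)

text \<open>Let \<open>v\<close> be a vertex of \<open>P\<close> and \<open>w\<close> the corresponding vertex of \<open>Q\<close>. Translating \<open>Q\<close> by the lattice
  vector \<open>v - w\<close> yields the contraction of \<open>P\<close> towards \<open>v\<close>, which is contained in \<open>P\<close>; minimality of
  \<open>P\<close> does the rest.\<close>

lemma translate_of_smaller_homothetic_minimal:
  assumes minP: "minimal_recoding_polygon A X P" and minQ: "minimal_recoding_polygon A X Q"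
    and Q: "Q = (\<lambda>p. t + c *\<^sub>R p) ` P" and c: "0 < c" "c \<le> 1"
  obtains s where "Q = (+) s ` P"
proof -
  have int: "convex_integer_polygon P" "convex_integer_polygon Q"
    using minP minQ unfolding minimal_recoding_polygon_def recoding_polygons_def coding_polygon_def by blast+
  then have P: "polytope P" "P \<noteq> {}" by (auto simp: convex_integer_polygon_def)
  obtain v where v: "v extreme_point_of P"
    using extreme_point_exists_convex[OF polytope_imp_compact[OF P(1)] polytope_imp_convex[OF P(1)] P(2)] by blast
  define w where "w = t + c *\<^sub>R v"
  have w: "w extreme_point_of Q"
  proof -
    have "(\<lambda>p. c *\<^sub>R p) ` {v} face_of (\<lambda>p. c *\<^sub>R p) ` P"
      using v c by (subst face_of_linear_image) (auto simp: face_of_singleton linear_scale_self injective_scaleR)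
    then have "(+) t ` (\<lambda>p. c *\<^sub>R p) ` {v} face_of (+) t ` (\<lambda>p. c *\<^sub>R p) ` P"
      unfolding face_of_translation_eq .
    then show ?thesis by (simp add: face_of_singleton image_image w_def Q)
  qed
  obtain v' w' where vw: "v = lattice_point v'" "w = lattice_point w'"
    using v w int unfolding convex_integer_polygon_def by blast
  define Q' where "Q' = (+) (lattice_point (v' - w')) ` Q"
  have "Q' \<subseteq> P"
  proof
    fix y assume "y \<in> Q'"
    then obtain p where p: "p \<in> P" "y = lattice_point (v' - w') + (t + c *\<^sub>R p)" by (auto simp: Q'_def Q)
    then have "y = (1 - c) *\<^sub>R v + c *\<^sub>R p"
      by (simp add: lattice_point_simps flip: vw) (simp add: w_def algebra_simps)
    then show "y \<in> P"
      using convexD_alt[OF polytope_imp_convex[OF P(1)], of v p c] v p(1) c by (simp add: extreme_point_of_def)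
  qed
  moreover have "Q' \<in> recoding_polygons A X"
    unfolding Q'_def using minQ by (intro recoding_polygons_translation) (simp add: minimal_recoding_polygon_def)
  moreover have "num_edges Q' = num_edges P"
    unfolding Q'_def num_edges_translation
    using minP minQ unfolding minimal_recoding_polygon_def by (meson order_antisym)
  ultimately have "Q' = P" using minP unfolding minimal_recoding_polygon_def by blast
  moreover have "Q = (+) (- lattice_point (v' - w')) ` Q'" by (simp add: Q'_def image_image)
  ultimately show ?thesis using that by blast
qed

lemma homothetic_minimal_recoding_polygons:
  assumes minP: "minimal_recoding_polygon A X P" and minQ: "minimal_recoding_polygon A X Q"
    and hom: "homothetic P Q"
  shows "differ_by_translation P Q"
proof -
  obtain c t where c: "c > 0" and Q: "Q = (\<lambda>p. t + c *\<^sub>R p) ` P"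
    using hom unfolding homothetic_def by blast
  show ?thesis
  proof (cases "c \<le> 1")
    case True
    then show ?thesis
      using translate_of_smaller_homothetic_minimal[OF minP minQ Q c] unfolding differ_by_translation_def by metis
  next
    case False
    then obtain s where "P = (+) s ` Q"
      using translate_of_smaller_homothetic_minimal[OF minQ minP homothety_inverse[OF Q c]] c by auto
    then have "Q = (+) (- s) ` P" by (simp add: image_image)
    then show ?thesis unfolding differ_by_translation_def by blast
  qed
qed

lemma minimal_recoding_polygons_of_triangular_homothetic:
  fixes X :: "'a config set"
  assumes tri: "triangular A X"
    and minP: "minimal_recoding_polygon A X P" and minQ: "minimal_recoding_polygon A X Q"
  shows "homothetic P Q"
proof -
  have X: "subshift A X" "infinite X" using tri by (auto simp: triangular_def)
  obtain T where T: "coding_polygon X T" "2 simplex T" using tri unfolding triangular_def by blast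
  obtain C where C: "\<not> affine_dependent C" "int (card C) = 2 + 1" "T = convex hull C"
    using T(2) unfolding simplex_def by blast
  have "card C = 3" using C(2) by simp
  then obtain x y z where xyz: "C = {x, y, z}" "x \<noteq> y" "x \<noteq> z" "y \<noteq> z"
    unfolding card_3_iff by blast
  have ex: "\<exists>p. r = lattice_point p" if "r \<in> C" for r
  proof -
    have "r extreme_point_of T"
      unfolding C(3) extreme_point_of_convex_hull_affine_independent[OF C(1)] using that .
    then show ?thesis using T(1) unfolding coding_polygon_def convex_integer_polygon_def by blast
  qed
  have det: "det2 (y - x) (z - x) \<noteq> 0"
  proof
    assume "det2 (y - x) (z - x) = 0"
    then obtain k where "z - x = k *\<^sub>R (y - x)" using xyz det2_real_eq_0[of "y - x" "z - x"] by auto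
    then have "z = k *\<^sub>R y + (1 - k) *\<^sub>R x" by (simp add: algebra_simps)
    then have "collinear {y, z, x}" unfolding collinear_3_expand by blast
    then show False using C(1) xyz unfolding collinear_3_eq_affine_dependent by (simp add: insert_commute)
  qed
  have "\<exists>u v w. C = {u, v, w} \<and> 0 < det2 (v - u) (w - u)"
  proof (cases "0 < det2 (y - x) (z - x)")
    case True
    with xyz show ?thesis by blast
  next
    case False
    have "det2 (z - x) (y - x) = - det2 (y - x) (z - x)" by (simp add: det2_def)
    then have "0 < det2 (z - x) (y - x)" using False det by simp
    moreover have "C = {x, z, y}" using xyz by blast
    ultimately show ?thesis by blast
  qed
  then obtain u' v' w' where uvw': "C = {u', v', w'}" "0 < det2 (v' - u') (w' - u')" by blast
  obtain u v w where uvw: "u' = lattice_point u" "v' = lattice_point v" "w' = lattice_point w"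
    using ex[of u'] ex[of v'] ex[of w'] unfolding uvw'(1) by blast
  have pos: "0 < det2 (v - u) (w - u)"
    using uvw'(2) unfolding uvw lattice_point_simps(2)[symmetric] lattice_point_simps(3) by simp
  then have pos_rot: "0 < det2 (w - v) (u - v)" "0 < det2 (u - w) (v - w)"
    by (simp_all add: det2_def algebra_simps)
  have hull: "T = convex hull {lattice_point u, lattice_point v, lattice_point w}"
    "T = convex hull {lattice_point v, lattice_point w, lattice_point u}"
    "T = convex hull {lattice_point w, lattice_point u, lattice_point v}"
    unfolding C(3) uvw'(1) uvw by (simp_all add: insert_commute)
  define d1 d2 d3 where "d1 = lattice_point (v - u)" "d2 = lattice_point (w - v)" "d3 = lattice_point (u - w)"
  note d_def = this
  have sum: "d1 + d2 + d3 = 0" by (simp add: d_def lattice_point_simps)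
  have "det2 (v - u) (w - v) = det2 (v - u) (w - u)" by (simp add: det2_def algebra_simps)
  then have posd: "0 < det2 d1 d2" using pos by (simp add: d_def lattice_point_simps(3))
  have "\<exists>k1 k2 k3. R = {x. k1 \<le> det2 d1 x \<and> k2 \<le> det2 d2 x \<and> k3 \<le> det2 d3 x} \<and> k1 + k2 + k3 < 0"
    if minR: "minimal_recoding_polygon A X R" for R
  proof -
    obtain B :: "nat set" and Y where Y: "recoding A X B Y" "coding_polygon Y R"
      using minR unfolding minimal_recoding_polygon_def recoding_polygons_def by blast
    have "polytope R" using Y(2) unfolding coding_polygon_def convex_integer_polygon_def by blast
    moreover have "num_edges R \<le> 3"
    proof -
      have "num_edges R \<le> num_edges T"
        using minR coding_polygon_in_recoding_polygons[OF X(1) T(1)] unfolding minimal_recoding_polygon_def by blast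
      also have "\<dots> \<le> 3" unfolding C(3) uvw'(1) by (rule ccw_triangle_num_edges_le[OF uvw'(2)])
      finally show ?thesis .
    qed
    moreover note edge = triangle_edge_direction_in_recoding[OF Y(1) X _ _ Y(2)]
    obtain p1 q1 \<mu>1 where e1: "(p1, q1) \<in> oriented_edges R" "\<mu>1 > 0" "q1 - p1 = \<mu>1 *\<^sub>R d1"
      using edge[OF T(1)[unfolded hull(3)] pos_rot(2)] unfolding d_def by metis
    obtain p2 q2 \<mu>2 where e2: "(p2, q2) \<in> oriented_edges R" "\<mu>2 > 0" "q2 - p2 = \<mu>2 *\<^sub>R d2"
      using edge[OF T(1)[unfolded hull(1)] pos] unfolding d_def by metis
    obtain p3 q3 \<mu>3 where e3: "(p3, q3) \<in> oriented_edges R" "\<mu>3 > 0" "q3 - p3 = \<mu>3 *\<^sub>R d3"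
      using edge[OF T(1)[unfolded hull(2)] pos_rot(1)] unfolding d_def by metis
    ultimately show ?thesis
      using three_edge_polygon[OF _ _ posd sum e1 e2 e3] by metis
  qed
  from this[OF minP] this[OF minQ] show ?thesis
    by (elim exE conjE) (rule homothetic_triangles[OF posd sum])
qed

theorem corollary5p14:
  fixes A :: "'a set" and X :: "'a config set"
  assumes "polygonal A X"
  shows "(\<forall>P Q. minimal_recoding_polygon A X P \<and> minimal_recoding_polygon A X Q \<and> homothetic P Q
            \<longrightarrow> differ_by_translation P Q) \<and>
         (triangular A X \<longrightarrow>
           (\<forall>P Q. minimal_recoding_polygon A X P \<and> minimal_recoding_polygon A X Q
             \<longrightarrow> differ_by_translation P Q))"
proof (intro conjI impI allI; elim conjE)
  fix P Q
  assume "minimal_recoding_polygon A X P" "minimal_recoding_polygon A X Q" "homothetic P Q"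
  then show "differ_by_translation P Q" by (rule homothetic_minimal_recoding_polygons)
next
  fix P Q
  assume tri: "triangular A X" 
    and min: "minimal_recoding_polygon A X P" "minimal_recoding_polygon A X Q"
  show "differ_by_translation P Q"
    by (rule homothetic_minimal_recoding_polygons[OF min
          minimal_recoding_polygons_of_triangular_homothetic[OF tri min]])
qed

end
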